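(* Let $\mathbb F$ be a finite field of odd order and let $Q=Q_{a,b}$ be a quadratic quasigroup upon $\mathbb F$ that is not a Netto quasigroup. Let $\mathbb K$, $\mathbb K_0$ and $\mathbb K_1$ be the subfields of $\mathbb F$ generated by $\{a,b\}$, $\{a\}$ and $\{b\}$, respectively. Suppose there exists a $2$-generated subquasigroup of $Q$ that is neither trivial nor minimal. Then the $2$-generated subquasigroups of $Q$ that are neither trivial nor minimal are exactly the sets $\lambda\mathbb K+\mu$ with $\lambda\in\mathbb F^*$, $\mu\in\mathbb F$. Furthermore each of $-1,a,b,1-a,1-b$ is a square in $\mathbb F$, and one of the following holds: (i) every nonzero element of $\mathbb K_1$ is a square in $\mathbb F$ and $\mathbb K_0$ contains a nonsquare; in this case, for $s\in\mathbb K$, $\mathbb K$ is generated as a subquasigroup by $\{0,s\}$ if and only if $\chi(s)=1$ (in particular $\mathbb K$ is generated by $\{0,1\}$), and the minimal subquasigroups of $Q$ are exactly the sets $\zeta\mathbb K_1+\mu$ with $\mu,\zeta\in\mathbb F$, $\chi(\zeta)=-1$; (ii) every nonzero element of $\mathbb K_0$ is a square in $\mathbb F$ and $\mathbb K_1$ contains a nonsquare; in this case, for $\zeta\in\mathbb K$, $\mathbb K$ is generated as a subquasigroup by $\{0,\zeta\}$ if and only if $\chi(\zeta)=-1$, and the minimal subquasigroups of $Q$ are exactly the sets $s\mathbb K_0+\mu$ with $\mu,s\in\mathbb F$, $\chi(s)=1$.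
   Context: $\chi$ is the quadratic character of $\mathbb F$ ($\chi(0)=0$, $1$ on nonzero squares, $-1$ on nonsquares). For $a,b\in\mathbb F$ with $\chi(a)=\chi(b)\ne0$ and $\chi(1-a)=\chi(1-b)\ne0$, $Q_{a,b}$ is $(\mathbb F,* )$ with $x*y=x+a(y-x)$ if $\chi(y-x)\ge0$ and $x*y=x+b(y-x)$ if $\chi(y-x)=-1$. $Q_{a,b}$ is a Netto quasigroup if $\operatorname{char}(\mathbb F)>3$, $a+b=ab=1$ and $\chi(a)=\chi(-1)=-1$. A subquasigroup is trivial if it has at most one element; it is minimal if it is nontrivial and all its proper subquasigroups are trivial; it is $2$-generated if it is the smallest subquasigroup containing some set of at most two elements. *)

theory Defs
  imports "HOL-Computational_Algebra.Nth_Powers" "HOL-Library.Cardinality"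
begin

text \<open>
  Quasigroups and their subquasigroups are subsets of a type, paired with a binary operation on
  that type. The empty set counts as a quasigroup, in line with trivial subquasigroups having
  \<^emph>\<open>at most\<close> one element.
\<close>

definition quasigroup_on :: "'a set \<Rightarrow> ('a \<Rightarrow> 'a \<Rightarrow> 'a) \<Rightarrow> bool" where
  "quasigroup_on S f \<longleftrightarrow>
     (\<forall>x\<in>S. bij_betw (\<lambda>y. f x y) S S) \<and> (\<forall>y\<in>S. bij_betw (\<lambda>x. f x y) S S)"

definition subquasigroup :: "('a \<Rightarrow> 'a \<Rightarrow> 'a) \<Rightarrow> 'a set \<Rightarrow> bool" where
  "subquasigroup f S \<longleftrightarrow> quasigroup_on UNIV f \<and> quasigroup_on S f"

definition trivial_subquasigroup :: "('a \<Rightarrow> 'a \<Rightarrow> 'a) \<Rightarrow> 'a set \<Rightarrow> bool" where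
  "trivial_subquasigroup f S \<longleftrightarrow> subquasigroup f S \<and> finite S \<and> card S \<le> 1"

definition minimal_subquasigroup :: "('a \<Rightarrow> 'a \<Rightarrow> 'a) \<Rightarrow> 'a set \<Rightarrow> bool" where
  "minimal_subquasigroup f S \<longleftrightarrow>
     subquasigroup f S \<and> \<not> trivial_subquasigroup f S \<and>
     (\<forall>T. subquasigroup f T \<and> T \<subset> S \<longrightarrow> trivial_subquasigroup f T)"

definition subquasigroup_generated_by :: "('a \<Rightarrow> 'a \<Rightarrow> 'a) \<Rightarrow> 'a set \<Rightarrow> 'a set \<Rightarrow> bool" where
  "subquasigroup_generated_by f X S \<longleftrightarrow>
     subquasigroup f S \<and> X \<subseteq> S \<and> (\<forall>T. subquasigroup f T \<and> X \<subseteq> T \<longrightarrow> S \<subseteq> T)"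

definition two_generated :: "('a \<Rightarrow> 'a \<Rightarrow> 'a) \<Rightarrow> 'a set \<Rightarrow> bool" where
  "two_generated f S \<longleftrightarrow> (\<exists>X. finite X \<and> card X \<le> 2 \<and> subquasigroup_generated_by f X S)"

definition subfield_set :: "'a::field set \<Rightarrow> bool" where
  "subfield_set K \<longleftrightarrow>
     0 \<in> K \<and> 1 \<in> K \<and>
     (\<forall>x\<in>K. \<forall>y\<in>K. x + y \<in> K \<and> x * y \<in> K) \<and>
     (\<forall>x\<in>K. - x \<in> K \<and> inverse x \<in> K)"

definition subfield_generated :: "'a::field set \<Rightarrow> 'a set" where
  "subfield_generated X = \<Inter>{K. subfield_set K \<and> X \<subseteq> K}"

definition quad_char :: "'a::field \<Rightarrow> int" where
  "quad_char x = (if x = 0 then 0 else if is_square x then 1 else - 1)"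

definition quad_op :: "'a::field \<Rightarrow> 'a \<Rightarrow> 'a \<Rightarrow> 'a \<Rightarrow> 'a" where
  "quad_op a b x y = (if quad_char (y - x) \<ge> 0 then x + a * (y - x) else x + b * (y - x))"

definition is_quadratic_quasigroup :: "'a::field \<Rightarrow> 'a \<Rightarrow> bool" where
  "is_quadratic_quasigroup a b \<longleftrightarrow>
     quad_char a = quad_char b \<and> quad_char b \<noteq> 0 \<and>
     quad_char (1 - a) = quad_char (1 - b) \<and> quad_char (1 - b) \<noteq> 0"

definition is_netto_quasigroup :: "'a::field \<Rightarrow> 'a \<Rightarrow> bool" where
  "is_netto_quasigroup a b \<longleftrightarrow>
     is_quadratic_quasigroup a b \<and> CHAR('a) > 3 \<and> a + b = 1 \<and> a * b = 1 \<and>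
     quad_char a = - 1 \<and> quad_char (- 1 :: 'a) = - 1"

definition affine_image :: "'a::field \<Rightarrow> 'a set \<Rightarrow> 'a \<Rightarrow> 'a set" where
  "affine_image l K m = (\<lambda>x. l * x + m) ` K"

end

theory Submission
  imports Defs "HOL.Hull"
begin

text \<open>
  Affine maps with square linear part are automorphisms of \<open>Q\<^bsub>a,b\<^esub>\<close>, and those with nonsquare
  linear part are isomorphisms onto it from \<open>Q\<^bsub>b,a\<^esub>\<close>. So every subquasigroup generated by two
  points is an affine image of the subquasigroup \<open>S\<close> generated by \<open>0\<close> and \<open>1\<close> in \<open>Q\<^bsub>a,b\<^esub>\<close> or
  in \<open>Q\<^bsub>b,a\<^esub>\<close>, and \<open>S\<close> is invariant under \<open>u \<mapsto> (y - x) u + x\<close> whenever \<open>x, y \<in> S\<close> and \<open>y - x\<close>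
  is a square. If \<open>S\<close> contains a square other than \<open>0\<close> and \<open>1\<close>, comparing these maps produces
  enough translations to make \<open>S\<close> an additive group; the scalars that preserve this group form
  a subfield containing all squares of \<open>S\<close>, and it turns out to be \<open>S\<close>. Otherwise
  \<open>S = {0, 1, a}\<close> with \<open>a + b = a b = 1\<close>, which is the Netto case or the prime field of order 3.
  So \<open>S\<close> is the field generated by \<open>a\<close> if that field consists of squares, and the field
  generated by \<open>a\<close> and \<open>b\<close> if not. A line \<open>l F + m\<close> over such a field \<open>F\<close> fails to be minimal
  exactly if \<open>F\<close> contains a nonsquare, which turns the direction \<open>l\<close> into one of the opposite
  character, and that direction belongs to a different field.
\<close>

section \<open>Squares in a finite field\<close>

lemma is_square_mult_cancel_left:
  fixes s x :: "'a::field"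
  assumes "is_square s" "s \<noteq> 0"
  shows "is_square (s * x) \<longleftrightarrow> is_square x"
proof
  assume "is_square (s * x)"
  then obtain u v where "s * x = u\<^sup>2" "s = v\<^sup>2"
    using assms(1) by (auto simp: is_nth_power_def)
  then have "x = (u / v)\<^sup>2"
    using assms(2) by (auto simp: power_divide field_simps)
  then show "is_square x"
    by (rule is_nth_powerI)
qed (simp add: assms is_nth_power_mult)

lemma card_square_roots_le:
  fixes y :: "'a::idom"
  shows "card {x. x\<^sup>2 = y} \<le> 2"
proof (cases "\<exists>u. u\<^sup>2 = y")
  case True
  then obtain u where "u\<^sup>2 = y" by blast
  then have "{x. x\<^sup>2 = y} = {u, - u}"
    by (auto simp: power2_eq_iff)
  then show ?thesis
    by (simp add: card_insert_if)
qed simp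

lemma card_nonsquares_le:
  "card {x :: 'a::{field,finite}. \<not> is_square x} \<le> card {x :: 'a. x \<noteq> 0 \<and> is_square x}"
    (is "card ?N \<le> card ?Sq")
proof -
  have "card ?Sq + card ?N = card (?Sq \<union> ?N)"
    by (rule card_Un_disjoint [symmetric]) auto
  also have "?Sq \<union> ?N = (\<Union>y\<in>?Sq. {x. x\<^sup>2 = y})"
    by auto
  also have "card \<dots> \<le> (\<Sum>y\<in>?Sq. card {x. x\<^sup>2 = y})"
    by (rule card_UN_le) simp
  also have "\<dots> \<le> (\<Sum>y\<in>?Sq. 2)"
    by (intro sum_mono card_square_roots_le)
  finally show ?thesis
    by simp
qed

lemma is_square_mult_nonsquares:
  fixes z w :: "'a::{field,finite}"
  assumes z: "\<not> is_square z" and w: "\<not> is_square w"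
  shows "is_square (z * w)"
proof -
  let ?Sq = "{x :: 'a. x \<noteq> 0 \<and> is_square x}" and ?N = "{x :: 'a. \<not> is_square x}"
  have "z \<noteq> 0"
    using z by auto
  then have "card ((*) z ` ?Sq) = card ?Sq"
    by (simp add: card_image inj_on_def)
  moreover have "(*) z ` ?Sq \<subseteq> ?N"
    using z by (auto simp: is_square_mult_cancel_left mult.commute [of z])
  ultimately have "(*) z ` ?Sq = ?N"
    using card_nonsquares_le [where 'a = 'a] by (intro card_seteq) auto
  then obtain s where "is_square s" "z * w = z\<^sup>2 * s"
    using w by (auto simp: power2_eq_square mult.assoc)
  then show ?thesis
    by (simp add: is_nth_power_mult)
qed

lemma quad_char_mult:
  fixes x y :: "'a::{field,finite}"
  shows "quad_char (x * y) = quad_char x * quad_char y"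
  using is_square_mult_cancel_left [of x y] is_square_mult_cancel_left [of y x]
    is_square_mult_nonsquares [of x y]
  by (auto simp: quad_char_def mult.commute)

lemma quad_char_eq_1_iff: "quad_char x = 1 \<longleftrightarrow> x \<noteq> 0 \<and> is_square x"
  and quad_char_eq_minus_1_iff: "quad_char x = - 1 \<longleftrightarrow> \<not> is_square x"
  by (auto simp: quad_char_def)

lemma is_square_mult_iff:
  fixes x y :: "'a::{field,finite}"
  assumes "x \<noteq> 0" "y \<noteq> 0"
  shows "is_square (x * y) \<longleftrightarrow> (is_square x \<longleftrightarrow> is_square y)"
  using quad_char_mult [of x y] assms by (auto simp: quad_char_def split: if_splits)

section \<open>Subfields and their affine images\<close>

lemma subfield_set_zero: "subfield_set K \<Longrightarrow> 0 \<in> K"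
  and subfield_set_one: "subfield_set K \<Longrightarrow> 1 \<in> K"
  and subfield_set_add: "subfield_set K \<Longrightarrow> x \<in> K \<Longrightarrow> y \<in> K \<Longrightarrow> x + y \<in> K"
  and subfield_set_mult: "subfield_set K \<Longrightarrow> x \<in> K \<Longrightarrow> y \<in> K \<Longrightarrow> x * y \<in> K"
  and subfield_set_uminus: "subfield_set K \<Longrightarrow> x \<in> K \<Longrightarrow> - x \<in> K"
  and subfield_set_inverse: "subfield_set K \<Longrightarrow> x \<in> K \<Longrightarrow> inverse x \<in> K"
  by (simp_all add: subfield_set_def)

lemma subfield_set_diff: "subfield_set K \<Longrightarrow> x \<in> K \<Longrightarrow> y \<in> K \<Longrightarrow> x - y \<in> K"
  unfolding diff_conv_add_uminus by (intro subfield_set_add subfield_set_uminus)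

lemma subfield_set_divide: "subfield_set K \<Longrightarrow> x \<in> K \<Longrightarrow> y \<in> K \<Longrightarrow> x / y \<in> K"
  unfolding divide_inverse by (intro subfield_set_mult subfield_set_inverse)

lemma subfield_setI:
  fixes L :: "'a::{field,finite} set"
  assumes zero: "0 \<in> L" and one: "1 \<in> L"
    and add: "\<And>x y. x \<in> L \<Longrightarrow> y \<in> L \<Longrightarrow> x + y \<in> L"
    and mult: "\<And>x y. x \<in> L \<Longrightarrow> y \<in> L \<Longrightarrow> x * y \<in> L"
  shows "subfield_set L"
proof -
  have "- x \<in> L" if "x \<in> L" for x
  proof -
    have "(+) x ` L = L"
      using that add by (intro endo_inj_surj) auto
    then obtain y where "y \<in> L" "0 = x + y"
      using zero by blast
    then show ?thesis
      by (metis minus_unique)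
  qed
  moreover have "inverse x \<in> L" if "x \<in> L" for x
  proof (cases "x = 0")
    case False
    then have "(*) x ` L = L"
      using that mult by (intro endo_inj_surj) (auto simp: inj_on_def)
    then obtain y where "y \<in> L" "1 = x * y"
      using one by blast
    then show ?thesis
      by (metis inverse_unique)
  qed (simp add: zero)
  ultimately show ?thesis
    using assms by (simp add: subfield_set_def)
qed

lemma subfield_generated_eq_hull: "subfield_generated X = subfield_set hull X"
  by (simp add: subfield_generated_def hull_def)

lemma subfield_set_subfield_generated: "subfield_set (subfield_generated X)"
  unfolding subfield_generated_eq_hull by (rule hull_in) (auto simp: subfield_set_def)

lemma affine_image_scale_shift:
  assumes "subfield_set K" and "u \<in> K" "u \<noteq> 0" "v \<in> K"
  shows "affine_image (l * u) K (l * v + m) = affine_image l K m"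
proof -
  have "(\<lambda>k. u * k + v) ` K = K"
  proof
    show "(\<lambda>k. u * k + v) ` K \<subseteq> K"
      using assms by (auto intro: subfield_set_add subfield_set_mult)
    show "K \<subseteq> (\<lambda>k. u * k + v) ` K"
    proof
      fix k assume "k \<in> K"
      then have "(k - v) / u \<in> K"
        using assms by (intro subfield_set_divide subfield_set_diff)
      moreover have "k = u * ((k - v) / u) + v"
        using \<open>u \<noteq> 0\<close> by simp
      ultimately show "k \<in> (\<lambda>k. u * k + v) ` K"
        by blast
    qed
  qed
  moreover have "affine_image (l * u) K (l * v + m) = affine_image l ((\<lambda>k. u * k + v) ` K) m"
    by (simp add: affine_image_def image_image algebra_simps)
  ultimately show ?thesis
    by simp
qed

lemma affine_image_scale:
  assumes "subfield_set K" "u \<in> K" "u \<noteq> 0"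
  shows "affine_image (l * u) K m = affine_image l K m"
  using affine_image_scale_shift [OF assms subfield_set_zero [OF assms(1)]] by simp

lemma affine_image_differenceE:
  assumes subfield: "subfield_set K" and "x \<in> affine_image l K m" "y \<in> affine_image l K m" "x \<noteq> y"
  obtains k where "k \<in> K" "k \<noteq> 0" "y - x = l * k" "affine_image (y - x) K x = affine_image l K m"
proof -
  obtain u v where uv: "u \<in> K" "x = l * u + m" "v \<in> K" "y = l * v + m"
    using assms(2,3) by (auto simp: affine_image_def)
  then have "v - u \<in> K" "v - u \<noteq> 0" "y - x = l * (v - u)"
    using subfield \<open>x \<noteq> y\<close> by (auto intro: subfield_set_diff simp: algebra_simps)
  then show ?thesis
    using that [of "v - u"] affine_image_scale_shift [OF subfield _ _ uv(1)] uv(2) by simp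
qed

lemma affine_image_1_0 [simp]: "affine_image 1 K 0 = K"
  and affine_image_0_1: "affine_image l {0, 1} m = {m, l + m}"
  by (simp_all add: affine_image_def)

lemma affine_image_inject:
  assumes "l \<noteq> 0"
  shows "affine_image l K m = affine_image l L m \<longleftrightarrow> K = L"
  unfolding affine_image_def using assms by (intro inj_image_eq_iff injI) simp

section \<open>Finite quasigroups\<close>

definition op_closed :: "('a \<Rightarrow> 'a \<Rightarrow> 'a) \<Rightarrow> 'a set \<Rightarrow> bool" where
  "op_closed f S \<longleftrightarrow> (\<forall>x\<in>S. \<forall>y\<in>S. f x y \<in> S)"

lemma op_closedD: "op_closed f S \<Longrightarrow> x \<in> S \<Longrightarrow> y \<in> S \<Longrightarrow> f x y \<in> S"
  by (simp add: op_closed_def)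

lemma op_closed_hull: "op_closed f (op_closed f hull X)"
  by (rule hull_in) (auto simp: op_closed_def)

lemma op_closed_hull_image:
  assumes hom: "\<And>x y. f (h x) (h y) = h (g x y)"
  shows "op_closed f hull (h ` X) = h ` (op_closed g hull X)"
proof (rule hull_unique)
  show "h ` X \<subseteq> h ` (op_closed g hull X)"
    by (intro image_mono hull_subset)
  show "op_closed f (h ` (op_closed g hull X))"
    using op_closedD [OF op_closed_hull [of g X]] by (auto simp: op_closed_def hom)
next
  fix S assume "h ` X \<subseteq> S" "op_closed f S"
  then have "op_closed g hull X \<subseteq> h -` S"
    by (intro hull_minimal) (auto simp: op_closed_def simp flip: hom)
  then show "h ` (op_closed g hull X) \<subseteq> S"
    by blast
qed

locale finite_quasigroup =
  fixes f :: "'a::finite \<Rightarrow> 'a \<Rightarrow> 'a"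
  assumes quasigroup: "quasigroup_on UNIV f"
begin

lemma subquasigroup_iff: "subquasigroup f S \<longleftrightarrow> op_closed f S"
proof
  assume "subquasigroup f S"
  then show "op_closed f S"
    unfolding subquasigroup_def quasigroup_on_def op_closed_def by (meson bij_betwE)
next
  assume closed: "op_closed f S"
  have "bij_betw g S S" if "bij g" "g ` S \<subseteq> S" for g
  proof -
    have "inj_on g S"
      using \<open>bij g\<close> by (auto simp: bij_def intro: inj_on_subset)
    then show ?thesis
      using that(2) by (simp add: bij_betw_def endo_inj_surj)
  qed
  then have "quasigroup_on S f"
    using quasigroup closed by (simp add: quasigroup_on_def op_closed_def image_subset_iff)
  then show "subquasigroup f S"
    using quasigroup by (simp add: subquasigroup_def)
qed

lemma subquasigroup_generated_by_iff:
  "subquasigroup_generated_by f X S \<longleftrightarrow> S = op_closed f hull X"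
  unfolding subquasigroup_generated_by_def subquasigroup_iff
  using op_closed_hull [of f X] by (metis hull_minimal hull_subset hull_unique)

end

locale finite_idempotent_quasigroup = finite_quasigroup +
  assumes idem: "f x x = x"
begin

lemma trivial_subquasigroup_iff:
  "trivial_subquasigroup f S \<longleftrightarrow> (\<forall>x\<in>S. \<forall>y\<in>S. x = y)"
  unfolding trivial_subquasigroup_def subquasigroup_iff op_closed_def One_nat_def
  by (simp only: card_le_Suc0_iff_eq finite) (metis idem)

lemma minimal_subquasigroup_iff:
  "minimal_subquasigroup f S \<longleftrightarrow>
    (\<exists>x\<in>S. \<exists>y\<in>S. x \<noteq> y) \<and> (\<forall>x\<in>S. \<forall>y\<in>S. x \<noteq> y \<longrightarrow> op_closed f hull {x, y} = S)"
    (is "_ \<longleftrightarrow> ?two_points \<and> ?generated")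
proof (intro iffI conjI)
  assume minimal: "minimal_subquasigroup f S"
  then show ?two_points
    by (auto simp: minimal_subquasigroup_def trivial_subquasigroup_iff)
  show ?generated
  proof (intro ballI impI, rule ccontr)
    fix x y assume xy: "x \<in> S" "y \<in> S" "x \<noteq> y" and "op_closed f hull {x, y} \<noteq> S"
    moreover have "op_closed f hull {x, y} \<subseteq> S"
      using minimal xy
      by (intro hull_minimal) (auto simp: minimal_subquasigroup_def subquasigroup_iff)
    ultimately have "trivial_subquasigroup f (op_closed f hull {x, y})"
      using minimal op_closed_hull [of f "{x, y}"]
      by (auto simp: minimal_subquasigroup_def subquasigroup_iff)
    moreover have "x \<in> op_closed f hull {x, y}" "y \<in> op_closed f hull {x, y}"
      by (simp_all add: hull_inc)
    ultimately show False
      using xy(3) by (auto simp: trivial_subquasigroup_iff)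
  qed
next
  assume generated: "?two_points \<and> ?generated"
  then have "op_closed f S"
    using op_closed_hull by metis
  moreover have "trivial_subquasigroup f T" if T: "op_closed f T" "T \<subset> S" for T
  proof (unfold trivial_subquasigroup_iff, intro ballI, rule ccontr)
    fix x y assume xy: "x \<in> T" "y \<in> T" "x \<noteq> y"
    then have "op_closed f hull {x, y} \<subseteq> T"
      using T(1) by (intro hull_minimal) auto
    moreover have "op_closed f hull {x, y} = S"
      using generated xy T(2) by auto
    ultimately show False
      using T(2) by blast
  qed
  ultimately show "minimal_subquasigroup f S"
    using generated
    by (auto simp: minimal_subquasigroup_def trivial_subquasigroup_iff subquasigroup_iff)
qed

lemma nontrivial_two_generated_iff:
  "two_generated f S \<and> \<not> trivial_subquasigroup f S \<longleftrightarrow>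
    (\<exists>x y. x \<noteq> y \<and> S = op_closed f hull {x, y})"
proof
  assume nontrivial: "two_generated f S \<and> \<not> trivial_subquasigroup f S"
  then obtain X where X: "card X \<le> 2" "S = op_closed f hull X"
    by (auto simp: two_generated_def subquasigroup_generated_by_iff)
  have "\<not> card X \<le> Suc 0"
  proof
    assume "card X \<le> Suc 0"
    then have "\<forall>x\<in>X. \<forall>y\<in>X. x = y"
      by (simp add: card_le_Suc0_iff_eq)
    moreover from this have "op_closed f X"
      using idem by (metis op_closed_def)
    ultimately show False
      using nontrivial X(2) by (simp add: hull_same trivial_subquasigroup_iff)
  qed
  then have "card X = 2"
    using X(1) by linarith
  then show "\<exists>x y. x \<noteq> y \<and> S = op_closed f hull {x, y}"
    using X(2) by (auto simp: card_2_iff)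
next
  assume "\<exists>x y. x \<noteq> y \<and> S = op_closed f hull {x, y}"
  then obtain x y where xy: "x \<noteq> y" "S = op_closed f hull {x, y}"
    by blast
  then have "two_generated f S"
    unfolding two_generated_def subquasigroup_generated_by_iff
    by (intro exI [of _ "{x, y}"]) auto
  moreover have "x \<in> S" "y \<in> S"
    using xy(2) by (simp_all add: hull_inc)
  ultimately show "two_generated f S \<and> \<not> trivial_subquasigroup f S"
    using xy(1) by (auto simp: trivial_subquasigroup_iff)
qed

lemma minimal_subquasigroup_two_generated:
  assumes "minimal_subquasigroup f S"
  shows "two_generated f S \<and> \<not> trivial_subquasigroup f S"
  using assms unfolding nontrivial_two_generated_iff minimal_subquasigroup_iff by metis

end

section \<open>Quasigroups whose 2-generated subquasigroups are lines over subfields\<close>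

locale line_quasigroup = finite_idempotent_quasigroup f
  for f :: "'a::{field,finite} \<Rightarrow> 'a \<Rightarrow> 'a" +
  fixes F :: "int \<Rightarrow> 'a set"
  assumes subfield: "subfield_set (F c)"
    and hull_pair: "x \<noteq> y \<Longrightarrow>
      op_closed f hull {x, y} = affine_image (y - x) (F (quad_char (y - x))) x"
begin

abbreviation line :: "'a \<Rightarrow> 'a \<Rightarrow> 'a set" where
  "line l m \<equiv> affine_image l (F (quad_char l)) m"

lemma nontrivial_two_generated_iff_line:
  "two_generated f S \<and> \<not> trivial_subquasigroup f S \<longleftrightarrow> (\<exists>l m. l \<noteq> 0 \<and> S = line l m)"
  unfolding nontrivial_two_generated_iff
proof
  assume "\<exists>x y. x \<noteq> y \<and> S = op_closed f hull {x, y}"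
  then show "\<exists>l m. l \<noteq> 0 \<and> S = line l m"
    using hull_pair by (metis right_minus_eq)
next
  assume "\<exists>l m. l \<noteq> 0 \<and> S = line l m"
  then obtain l m where "l \<noteq> 0" "S = line l m"
    by blast
  then have "m \<noteq> l + m" "S = op_closed f hull {m, l + m}"
    using hull_pair [of m "l + m"] by simp_all
  then show "\<exists>x y. x \<noteq> y \<and> S = op_closed f hull {x, y}"
    by blast
qed

lemma line_nontrivial:
  assumes "l \<noteq> 0"
  shows "\<exists>x\<in>line l m. \<exists>y\<in>line l m. x \<noteq> y"
  using assms nontrivial_two_generated_iff_line [of "line l m"]
  by (auto simp: trivial_subquasigroup_iff)

lemma hull_pair_in_line:
  assumes "x \<in> line l m" "y \<in> line l m" "x \<noteq> y"
    and same_or_squares: "F 1 = F (- 1) \<or> (\<forall>k\<in>F (quad_char l). is_square k)"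
  shows "op_closed f hull {x, y} = line l m"
proof -
  obtain k where k: "k \<in> F (quad_char l)" "k \<noteq> 0" "y - x = l * k"
    and rebased: "affine_image (y - x) (F (quad_char l)) x = line l m"
    using affine_image_differenceE [OF subfield assms(1-3)] .
  have "F 1 = F (- 1) \<or> quad_char (y - x) = quad_char l"
    using same_or_squares k by (auto simp: quad_char_mult quad_char_eq_1_iff [THEN iffD2])
  moreover have "l \<noteq> 0"
    using k(3) \<open>x \<noteq> y\<close> by auto
  ultimately have "F (quad_char (y - x)) = F (quad_char l)"
    using \<open>x \<noteq> y\<close> by (auto simp: quad_char_def)
  then show ?thesis
    using hull_pair [OF \<open>x \<noteq> y\<close>] rebased by simp
qed

lemma minimal_line_imp_same_field:
  assumes minimal: "minimal_subquasigroup f (line l m)"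
    and "l \<noteq> 0" and k: "k \<in> F (quad_char l)" "\<not> is_square k"
  shows "F 1 = F (- 1)"
proof -
  have "k \<noteq> 0"
    using k(2) by auto
  have "m \<in> line l m" "l * k + m \<in> line l m"
    using k(1) subfield_set_zero [OF subfield] by (force simp: affine_image_def)+
  then have "line l m = op_closed f hull {m, l * k + m}"
    using minimal \<open>l \<noteq> 0\<close> \<open>k \<noteq> 0\<close> by (simp add: minimal_subquasigroup_iff)
  also have "\<dots> = affine_image (l * k) (F (- quad_char l)) m"
    using \<open>l \<noteq> 0\<close> \<open>k \<noteq> 0\<close> k(2) hull_pair [of m "l * k + m"]
    by (simp add: quad_char_mult quad_char_eq_minus_1_iff [THEN iffD2])
  also have "line l m = affine_image (l * k) (F (quad_char l)) m"
    by (rule affine_image_scale [OF subfield k(1) \<open>k \<noteq> 0\<close>, symmetric])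
  finally have "F (quad_char l) = F (- quad_char l)"
    using \<open>l \<noteq> 0\<close> \<open>k \<noteq> 0\<close> by (simp add: affine_image_inject)
  then show ?thesis
    using \<open>l \<noteq> 0\<close> by (auto simp: quad_char_def split: if_splits)
qed

lemma minimal_line_iff:
  assumes "l \<noteq> 0"
  shows "minimal_subquasigroup f (line l m) \<longleftrightarrow>
    F 1 = F (- 1) \<or> (\<forall>k\<in>F (quad_char l). is_square k)"
  using minimal_line_imp_same_field [OF _ assms] hull_pair_in_line line_nontrivial [OF assms]
  by (auto simp: minimal_subquasigroup_iff)

lemma nonminimal_imp_mixed_fields:
  assumes "two_generated f S \<and> \<not> trivial_subquasigroup f S" "\<not> minimal_subquasigroup f S"
  shows "F 1 \<noteq> F (- 1)" "\<exists>k\<in>F 1 \<union> F (- 1). \<not> is_square k"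
proof -
  obtain l m where "l \<noteq> 0" "\<not> minimal_subquasigroup f (line l m)"
    using assms(2) iffD1 [OF nontrivial_two_generated_iff_line assms(1)] by blast
  then have "F 1 \<noteq> F (- 1) \<and> (\<exists>k\<in>F (quad_char l). \<not> is_square k)"
    by (simp add: minimal_line_iff)
  moreover have "quad_char l = 1 \<or> quad_char l = - 1"
    using \<open>l \<noteq> 0\<close> by (simp add: quad_char_def)
  ultimately show "F 1 \<noteq> F (- 1)" "\<exists>k\<in>F 1 \<union> F (- 1). \<not> is_square k"
    by auto
qed

end

locale mixed_line_quasigroup = line_quasigroup +
  fixes e :: int
  assumes sign: "e = 1 \<or> e = - 1"
    and squares: "\<forall>k\<in>F (- e). is_square k"
    and nonsquare: "\<exists>k\<in>F e. \<not> is_square k"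
begin

lemma quad_char_eq_sign_cases: "x \<noteq> 0 \<Longrightarrow> quad_char x = e \<or> quad_char x = - e"
  using sign by (auto simp: quad_char_def)

lemma nonzero_if_quad_char_sign: "quad_char x = e \<Longrightarrow> x \<noteq> 0"
  and nonzero_if_quad_char_minus_sign: "quad_char x = - e \<Longrightarrow> x \<noteq> 0"
  using sign by (auto simp: quad_char_def)

lemma minimal_line_iff_quad_char:
  assumes "l \<noteq> 0"
  shows "minimal_subquasigroup f (line l m) \<longleftrightarrow> quad_char l = - e"
proof -
  have "F 1 \<noteq> F (- 1)"
    using sign squares nonsquare by auto
  then show ?thesis
    using quad_char_eq_sign_cases [OF assms] squares nonsquare sign
    by (auto simp: minimal_line_iff [OF assms])
qed

lemma affine_image_lineE:
  assumes "l \<noteq> 0"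
  obtains l' where "quad_char l' = e"
    "affine_image l (F e) m = line l' m"
proof (cases "quad_char l = e")
  case False
  obtain k where k: "k \<in> F e" "\<not> is_square k" "k \<noteq> 0"
    using nonsquare by (metis is_nth_power_0 zero_less_numeral)
  have "quad_char (l * k) = e"
    using False quad_char_eq_sign_cases [OF assms] k(2)
    by (auto simp: quad_char_mult quad_char_eq_minus_1_iff [THEN iffD2])
  moreover have "affine_image (l * k) (F e) m = affine_image l (F e) m"
    by (rule affine_image_scale [OF subfield k(1,3)])
  ultimately show ?thesis
    using that by metis
qed (use that in auto)

lemma nonminimal_two_generated_eq:
  "{S. two_generated f S \<and> \<not> trivial_subquasigroup f S \<and> \<not> minimal_subquasigroup f S}
    = {affine_image l (F e) m | l m. l \<noteq> 0}"
proof (intro set_eqI iffI)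
  fix S assume "S \<in> {affine_image l (F e) m | l m. l \<noteq> 0}"
  then obtain l m where "quad_char l = e" "S = line l m"
    using affine_image_lineE by blast
  moreover from this have "l \<noteq> 0" "quad_char l \<noteq> - e"
    using sign nonzero_if_quad_char_sign by auto
  ultimately show "S \<in> {S. two_generated f S \<and> \<not> trivial_subquasigroup f S \<and>
      \<not> minimal_subquasigroup f S}"
    using nontrivial_two_generated_iff_line [of S] minimal_line_iff_quad_char by auto
next
  fix S assume nonminimal: "S \<in> {S. two_generated f S \<and> \<not> trivial_subquasigroup f S \<and>
      \<not> minimal_subquasigroup f S}"
  then obtain l m where l: "l \<noteq> 0" "S = line l m"
    using nontrivial_two_generated_iff_line [of S] by auto
  then have "quad_char l = e"
    using nonminimal minimal_line_iff_quad_char quad_char_eq_sign_cases by blast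
  then show "S \<in> {affine_image l (F e) m | l m. l \<noteq> 0}"
    using l by blast
qed

lemma minimal_subquasigroups_eq:
  "{S. minimal_subquasigroup f S} = {affine_image l (F (- e)) m | l m. quad_char l = - e}"
proof (intro set_eqI iffI)
  fix S assume minimal: "S \<in> {S. minimal_subquasigroup f S}"
  then obtain l m where "l \<noteq> 0" "S = line l m"
    using minimal_subquasigroup_two_generated [of S] nontrivial_two_generated_iff_line [of S]
    by auto
  moreover from this have "quad_char l = - e"
    using minimal by (simp add: minimal_line_iff_quad_char)
  ultimately show "S \<in> {affine_image l (F (- e)) m | l m. quad_char l = - e}"
    by auto
next
  fix S assume "S \<in> {affine_image l (F (- e)) m | l m. quad_char l = - e}"
  then obtain l m where l: "quad_char l = - e" "S = affine_image l (F (- e)) m"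
    by blast
  then show "S \<in> {S. minimal_subquasigroup f S}"
    using minimal_line_iff_quad_char [OF nonzero_if_quad_char_minus_sign [OF l(1)], of m] by simp
qed

lemma generated_by_zero_iff:
  assumes "s \<in> F e"
  shows "subquasigroup_generated_by f {0, s} (F e) \<longleftrightarrow> quad_char s = e"
  unfolding subquasigroup_generated_by_iff
proof
  assume generated: "F e = op_closed f hull {0, s}"
  have "F e \<in> {affine_image l (F e) m | l m. l \<noteq> 0}"
    by (intro CollectI exI [of _ 1] exI [of _ 0]) simp
  then have nonminimal: "\<not> trivial_subquasigroup f (F e)" "\<not> minimal_subquasigroup f (F e)"
    unfolding nonminimal_two_generated_eq [symmetric] by simp_all
  have "s \<noteq> 0"
  proof
    assume "s = 0"
    then have "F e = {0}"
      using generated idem by (simp add: hull_same op_closed_def)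
    then show False
      using nonminimal(1) by (simp add: trivial_subquasigroup_iff)
  qed
  moreover from this have "quad_char s \<noteq> - e"
    using nonminimal(2) minimal_line_iff_quad_char [of s 0] hull_pair [of 0 s] generated by auto
  ultimately show "quad_char s = e"
    using quad_char_eq_sign_cases by blast
next
  assume s: "quad_char s = e"
  then have "s \<noteq> 0"
    by (rule nonzero_if_quad_char_sign)
  then show "F e = op_closed f hull {0, s}"
    using s assms hull_pair [of 0 s] affine_image_scale [OF subfield, of s e 1 0] by simp
qed

end

section \<open>Quadratic quasigroups\<close>

definition quad_scale :: "'a::field \<Rightarrow> 'a \<Rightarrow> 'a \<Rightarrow> 'a" where
  "quad_scale a b d = (if is_square d then a else b) * d"

lemma quad_op_eq_add: "quad_op a b x y = x + quad_scale a b (y - x)"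
  by (auto simp: quad_op_def quad_char_def quad_scale_def)

lemma quad_op_eq_diff: "quad_op a b x y = y - quad_scale (1 - a) (1 - b) (y - x)"
  by (auto simp: quad_op_def quad_char_def quad_scale_def algebra_simps)

lemma quad_scale_mult:
  fixes l :: "'a::{field,finite}"
  assumes "l \<noteq> 0"
  shows "quad_scale a b (l * d) =
    l * (if is_square l then quad_scale a b d else quad_scale b a d)"
  using is_square_mult_iff [OF assms, of d] by (cases "d = 0") (auto simp: quad_scale_def)

lemma inj_quad_scale:
  fixes a b :: "'a::{field,finite}"
  assumes "a \<noteq> 0" "b \<noteq> 0" "is_square a \<longleftrightarrow> is_square b"
  shows "inj (quad_scale a b)"
proof (rule injI)
  fix d d' assume eq: "quad_scale a b d = quad_scale a b d'"
  have square_iff: "is_square (quad_scale a b x) \<longleftrightarrow> (is_square a \<longleftrightarrow> is_square x)" if "x \<noteq> 0" for x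
    using assms that by (simp add: quad_scale_def is_square_mult_iff)
  have zero_iff: "quad_scale a b x = 0 \<longleftrightarrow> x = 0" for x
    using assms by (simp add: quad_scale_def)
  show "d = d'"
  proof (cases "d = 0")
    case True
    then show ?thesis
      using eq zero_iff by metis
  next
    case False
    then have "is_square d \<longleftrightarrow> is_square d'"
      using eq square_iff zero_iff by metis
    then show ?thesis
      using eq assms by (auto simp: quad_scale_def)
  qed
qed

lemma is_quadratic_quasigroup_iff:
  "is_quadratic_quasigroup a b \<longleftrightarrow>
     a \<noteq> 0 \<and> b \<noteq> 0 \<and> a \<noteq> 1 \<and> b \<noteq> 1 \<and>
     (is_square a \<longleftrightarrow> is_square b) \<and> (is_square (1 - a) \<longleftrightarrow> is_square (1 - b))"
  by (auto simp: is_quadratic_quasigroup_def quad_char_def)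

lemma quasigroup_on_quad_op:
  fixes a b :: "'a::{field,finite}"
  assumes "is_quadratic_quasigroup a b"
  shows "quasigroup_on UNIV (quad_op a b)"
proof -
  have inj: "inj (quad_scale a b)" "inj (quad_scale (1 - a) (1 - b))"
    using assms by (auto simp: is_quadratic_quasigroup_iff intro!: inj_quad_scale)
  have "inj (\<lambda>y. quad_op a b x y)" for x
    by (rule injI) (simp add: quad_op_eq_add inj_eq [OF inj(1)])
  moreover have "inj (\<lambda>x. quad_op a b x y)" for y
    by (rule injI) (simp add: quad_op_eq_diff inj_eq [OF inj(2)])
  ultimately show ?thesis
    by (simp add: quasigroup_on_def bij_def finite_UNIV_inj_surj)
qed

lemma op_closed_quad_op:
  assumes subfield: "subfield_set K" and "a \<in> K" and "b \<in> K \<or> (\<forall>x\<in>K. is_square x)"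
  shows "op_closed (quad_op a b) K"
  unfolding op_closed_def quad_op_eq_add
proof (intro ballI subfield_set_add [OF subfield])
  fix x y assume "x \<in> K" "y \<in> K"
  then have "y - x \<in> K"
    by (rule subfield_set_diff [OF subfield, rotated])
  then show "quad_scale a b (y - x) \<in> K"
    using assms by (auto simp: quad_scale_def intro: subfield_set_mult)
qed

definition unit_hull :: "'a::field \<Rightarrow> 'a \<Rightarrow> 'a set" where
  "unit_hull a b = op_closed (quad_op a b) hull {0, 1}"

definition line_hull :: "'a::field \<Rightarrow> 'a \<Rightarrow> int \<Rightarrow> 'a set" where
  "line_hull a b e = (if e = 1 then unit_hull a b else unit_hull b a)"

lemma hull_pair_quad_op:
  fixes a b :: "'a::{field,finite}"
  assumes "x \<noteq> y"
  shows "op_closed (quad_op a b) hull {x, y} =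
    affine_image (y - x) (line_hull a b (quad_char (y - x))) x"
proof -
  define l where "l = y - x"
  then have "l \<noteq> 0"
    using assms by simp
  define g where "g = (if is_square l then quad_op a b else quad_op b a)"
  have "quad_op a b (l * u + x) (l * v + x) = l * g u v + x" for u v
  proof -
    have "quad_op a b (l * u + x) (l * v + x) = l * u + x + quad_scale a b (l * (v - u))"
      by (simp add: quad_op_eq_add right_diff_distrib)
    then show ?thesis
      by (simp add: quad_scale_mult [OF \<open>l \<noteq> 0\<close>] g_def quad_op_eq_add distrib_left)
  qed
  then have "op_closed (quad_op a b) hull affine_image l {0, 1} x =
      affine_image l (op_closed g hull {0, 1}) x"
    unfolding affine_image_def by (rule op_closed_hull_image)
  moreover have "line_hull a b (quad_char l) = op_closed g hull {0, 1}"
    using \<open>l \<noteq> 0\<close> by (simp add: line_hull_def quad_char_def unit_hull_def g_def)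
  ultimately show ?thesis
    by (simp add: affine_image_0_1 l_def)
qed

section \<open>Sets closed under affine maps along square differences\<close>

definition translation_group :: "'a::field set \<Rightarrow> 'a set" where
  "translation_group S = {t. \<forall>u\<in>S. u + t \<in> S}"

definition translation_multipliers :: "'a::field set \<Rightarrow> 'a set" where
  "translation_multipliers S =
    {l. \<forall>t\<in>translation_group S. l * t \<in> translation_group S}"

lemma translation_group_zero: "0 \<in> translation_group S"
  and translation_group_add:
    "t \<in> translation_group S \<Longrightarrow> t' \<in> translation_group S \<Longrightarrow> t + t' \<in> translation_group S"
  by (auto simp: translation_group_def simp flip: add.assoc)

lemma subfield_set_translation_multipliers:
  fixes S :: "'a::{field,finite} set"
  shows "subfield_set (translation_multipliers S)"
  by (rule subfield_setI)
    (auto simp: translation_multipliers_def translation_group_zero translation_group_add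
      distrib_right mult.assoc)

lemma affine_image_eqI:
  fixes l :: "'a::{field,finite}"
  assumes "l \<noteq> 0" "\<And>u. u \<in> S \<Longrightarrow> l * u + m \<in> S"
  shows "affine_image l S m = S"
  unfolding affine_image_def using assms by (intro endo_inj_surj) (auto simp: inj_on_def)

locale square_segment_closed =
  fixes S :: "'a::{field,finite} set"
  assumes zero: "0 \<in> S" and one: "1 \<in> S"
    and segment: "x \<in> S \<Longrightarrow> y \<in> S \<Longrightarrow> is_square (y - x) \<Longrightarrow> u \<in> S \<Longrightarrow> (y - x) * u + x \<in> S"
begin

lemma translation_group_subset: "translation_group S \<subseteq> S"
  using zero by (force simp: translation_group_def)

lemma square_mult_closed: "p \<in> S \<Longrightarrow> is_square p \<Longrightarrow> u \<in> S \<Longrightarrow> p * u \<in> S"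
  using segment [OF zero, of p u] by simp

lemma square_in_translation_multipliers:
  assumes p: "p \<in> S" "is_square p"
  shows "p \<in> translation_multipliers S"
proof (cases "p = 0")
  case False
  then have permutes: "affine_image p S 0 = S"
    using square_mult_closed [OF p] by (intro affine_image_eqI) auto
  have "u + p * t \<in> S" if "t \<in> translation_group S" "u \<in> S" for t u
  proof -
    obtain v where "v \<in> S" "u = p * v"
      using permutes \<open>u \<in> S\<close> by (auto simp: affine_image_def)
    then have "p * (v + t) \<in> S"
      using square_mult_closed [OF p] \<open>t \<in> translation_group S\<close>
      by (auto simp: translation_group_def)
    then show ?thesis
      using \<open>u = p * v\<close> by (simp add: distrib_left)
  qed
  then show ?thesis
    by (auto simp: translation_multipliers_def translation_group_def)
qed (auto simp: translation_multipliers_def translation_group_def)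

lemma subset_translation_multipliers_if_nonsquare:
  assumes "translation_group S = S" and l: "l \<in> translation_multipliers S" "\<not> is_square l"
  shows "S \<subseteq> translation_multipliers S"
proof
  fix x assume "x \<in> S"
  show "x \<in> translation_multipliers S"
  proof (cases "is_square x")
    case False
    have "l * x \<in> S"
      using \<open>x \<in> S\<close> l(1) \<open>translation_group S = S\<close> by (simp add: translation_multipliers_def)
    then have "l * x \<in> translation_multipliers S"
      using l(2) False by (intro square_in_translation_multipliers is_square_mult_nonsquares)
    then have "l * x / l \<in> translation_multipliers S"
      by (rule subfield_set_divide [OF subfield_set_translation_multipliers _ l(1)])
    moreover have "l \<noteq> 0"
      using l(2) by auto
    ultimately show ?thesis
      by simp
  qed (simp add: square_in_translation_multipliers \<open>x \<in> S\<close>)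
qed

end

locale square_segment_closed_with_square = square_segment_closed S
  for S :: "'a::{field,finite} set" +
  fixes s :: 'a
  assumes s_square: "s \<in> S" "is_square s" "s \<noteq> 0" "s \<noteq> 1"
begin

text \<open>
  The maps \<open>u \<mapsto> s * ((y - x) * u + x)\<close> and \<open>u \<mapsto> (y - x) * (s * u) + x\<close> permute \<open>S\<close> and have the
  same linear part, so their quotient is the translation by \<open>(s - 1) * x\<close>.
\<close>

lemma translation_of_square_difference:
  assumes xy: "x \<in> S" "y \<in> S" "x \<noteq> y" "is_square (y - x)"
  shows "x \<in> translation_group S"
proof -
  define r where "r = y - x"
  have r: "r \<noteq> 0" "\<And>v. v \<in> S \<Longrightarrow> r * v + x \<in> S"
    using xy segment by (auto simp: r_def)
  have "r * s * v + x \<in> S" if "v \<in> S" for v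
    using r(2) [of "s * v"] square_mult_closed [OF s_square(1,2) that] by (simp add: mult.assoc)
  then have permutes: "affine_image (r * s) S x = S"
    using r(1) s_square(3) by (intro affine_image_eqI) auto
  have "u + (s - 1) * x \<in> S" if "u \<in> S" for u
  proof -
    obtain v where v: "v \<in> S" "u = r * s * v + x"
      using permutes \<open>u \<in> S\<close> by (auto simp: affine_image_def)
    then have "s * (r * v + x) \<in> S"
      using square_mult_closed [OF s_square(1,2)] r(2) by blast
    then show ?thesis
      using v(2) by (simp add: algebra_simps)
  qed
  then have "(s - 1) * x \<in> translation_group S"
    by (simp add: translation_group_def)
  moreover have "inverse (s - 1) \<in> translation_multipliers S"
    using subfield_set_translation_multipliers square_in_translation_multipliers [OF s_square(1,2)]
    by (auto intro: subfield_set_inverse subfield_set_diff subfield_set_one)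
  ultimately have "inverse (s - 1) * ((s - 1) * x) \<in> translation_group S"
    by (simp add: translation_multipliers_def)
  then show ?thesis
    using s_square(4) by (simp flip: mult.assoc)
qed

lemma one_translation: "1 \<in> translation_group S"
proof -
  consider (minus_1) "is_square (- 1 :: 'a)" | (s_minus_1) "is_square (s - 1)"
    | (one_minus_s) "is_square (1 - s)"
    using is_square_mult_nonsquares [of "- 1" "s - 1"] by auto
  then show ?thesis
  proof cases
    case minus_1
    then show ?thesis
      using translation_of_square_difference [OF one zero] by simp
  next
    case s_minus_1
    then show ?thesis
      using translation_of_square_difference [OF one s_square(1)] s_square(4) by simp
  next
    case one_minus_s
    then have "s \<in> translation_group S"
      using translation_of_square_difference [OF s_square(1) one] s_square(4) by simp
    moreover have "inverse s \<in> translation_multipliers S"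
      by (intro subfield_set_inverse subfield_set_translation_multipliers
          square_in_translation_multipliers s_square)
    ultimately have "inverse s * s \<in> translation_group S"
      by (simp add: translation_multipliers_def)
    then show ?thesis
      using s_square(3) by simp
  qed
qed

lemma translation_group_eq: "translation_group S = S"
proof (rule antisym [OF translation_group_subset subsetI])
  fix x assume "x \<in> S"
  moreover from this have "x + 1 \<in> S"
    using one_translation by (simp add: translation_group_def)
  ultimately show "x \<in> translation_group S"
    using translation_of_square_difference [of x "x + 1"] by simp
qed

lemma translation_multipliers_subset: "translation_multipliers S \<subseteq> S"
  using one_translation translation_group_subset by (force simp: translation_multipliers_def)

end

section \<open>The subquasigroup generated by 0 and 1\<close>

locale quadratic_quasigroup =
  fixes a b :: "'a::{field,finite}"
  assumes quadratic: "is_quadratic_quasigroup a b"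
begin

sublocale finite_idempotent_quasigroup "quad_op a b"
  by unfold_locales (simp_all add: quasigroup_on_quad_op quadratic quad_op_eq_add quad_scale_def)

lemma zero_in_unit_hull: "0 \<in> unit_hull a b"
  and one_in_unit_hull: "1 \<in> unit_hull a b"
  by (simp_all add: unit_hull_def hull_inc)

lemma quad_op_in_unit_hull:
  "x \<in> unit_hull a b \<Longrightarrow> y \<in> unit_hull a b \<Longrightarrow> quad_op a b x y \<in> unit_hull a b"
  unfolding unit_hull_def by (rule op_closedD [OF op_closed_hull])

lemma a_in_unit_hull: "a \<in> unit_hull a b"
  using quad_op_in_unit_hull [OF zero_in_unit_hull one_in_unit_hull]
  by (simp add: quad_op_eq_add quad_scale_def)

lemma b_mult_nonsquare_in_unit_hull: "x \<in> unit_hull a b \<Longrightarrow> \<not> is_square x \<Longrightarrow> b * x \<in> unit_hull a b"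
  using quad_op_in_unit_hull [OF zero_in_unit_hull, of x]
  by (simp add: quad_op_eq_add quad_scale_def)

lemma unit_hull_subset: "subfield_set K \<Longrightarrow> op_closed (quad_op a b) K \<Longrightarrow> unit_hull a b \<subseteq> K"
  unfolding unit_hull_def by (simp add: subset_hull subfield_set_zero subfield_set_one)

sublocale unit_hull: square_segment_closed "unit_hull a b"
proof
  fix x y u
  assume xyu: "x \<in> unit_hull a b" "y \<in> unit_hull a b" "is_square (y - x)" "u \<in> unit_hull a b"
  show "(y - x) * u + x \<in> unit_hull a b"
  proof (cases "x = y")
    case False
    then have "quad_char (y - x) = 1"
      using xyu(3) by (simp add: quad_char_def)
    then have "affine_image (y - x) (unit_hull a b) x = op_closed (quad_op a b) hull {x, y}"
      using hull_pair_quad_op [OF False, of a b] by (simp add: line_hull_def)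
    also have "\<dots> \<subseteq> unit_hull a b"
      using xyu(1,2) unfolding unit_hull_def by (intro hull_minimal op_closed_hull) simp
    finally show ?thesis
      using xyu(4) by (auto simp: affine_image_def)
  qed (simp add: xyu)
qed (fact zero_in_unit_hull one_in_unit_hull)+

lemma unit_hull_subset_translation_multipliers:
  assumes additive: "translation_group (unit_hull a b) = unit_hull a b"
  shows "unit_hull a b \<subseteq> translation_multipliers (unit_hull a b)" (is "unit_hull a b \<subseteq> ?L")
proof (cases "\<forall>l\<in>?L. is_square l")
  case False
  then show ?thesis
    using unit_hull.subset_translation_multipliers_if_nonsquare [OF additive] by blast
next
  case True
  note subfield_multipliers = subfield_set_translation_multipliers [of "unit_hull a b"]
  have "a \<in> ?L"
  proof (rule ccontr)
    assume "a \<notin> ?L"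
    then have "a + 1 \<notin> ?L"
      using subfield_set_diff [OF subfield_multipliers, of "a + 1" 1]
        subfield_set_one [OF subfield_multipliers] by auto
    have nonsquare: "\<not> is_square x" if "x \<in> unit_hull a b" "x \<notin> ?L" for x
      using that unit_hull.square_in_translation_multipliers by blast
    have "a + 1 \<in> unit_hull a b"
      using a_in_unit_hull one_in_unit_hull additive by (metis translation_group_add)
    have "\<not> is_square b"
      using nonsquare [OF a_in_unit_hull \<open>a \<notin> ?L\<close>] quadratic
      by (simp add: is_quadratic_quasigroup_iff)
    then have b_mult: "b * x \<in> ?L" if "x \<in> unit_hull a b" "x \<notin> ?L" for x
      using nonsquare [OF that] that(1)
      by (intro unit_hull.square_in_translation_multipliers is_square_mult_nonsquares
          b_mult_nonsquare_in_unit_hull)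
    have "b * (a + 1) - b * a \<in> ?L"
      using \<open>a \<notin> ?L\<close> \<open>a + 1 \<notin> ?L\<close> \<open>a + 1 \<in> unit_hull a b\<close> a_in_unit_hull
      by (intro subfield_set_diff [OF subfield_multipliers] b_mult)
    then show False
      using True \<open>\<not> is_square b\<close> by (simp add: distrib_left)
  qed
  then show ?thesis
    using True by (intro unit_hull_subset subfield_multipliers op_closed_quad_op) auto
qed

lemma subfield_set_unit_hull_of_square:
  assumes "s \<in> unit_hull a b" "is_square s" "s \<noteq> 0" "s \<noteq> 1"
  shows "subfield_set (unit_hull a b)"
proof -
  interpret square_segment_closed_with_square "unit_hull a b" s
    by unfold_locales (fact assms)+
  have "unit_hull a b = translation_multipliers (unit_hull a b)"
    using unit_hull_subset_translation_multipliers [OF translation_group_eq]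
      translation_multipliers_subset by blast
  then show ?thesis
    using subfield_set_translation_multipliers [of "unit_hull a b"] by simp
qed

lemma unit_hull_without_squares:
  assumes only: "\<forall>s\<in>unit_hull a b. is_square s \<longrightarrow> s = 0 \<or> s = 1"
  shows "\<not> is_square a" "a * b = 1" "unit_hull a b = {0, 1, a}"
proof -
  note coefficients = quadratic [unfolded is_quadratic_quasigroup_iff]
  show nonsquare_a: "\<not> is_square a"
    using only a_in_unit_hull coefficients by blast
  have b_mult: "b * x = 1" if x: "x \<in> unit_hull a b" "\<not> is_square x" for x
  proof -
    have "b * x \<in> unit_hull a b" "is_square (b * x)"
      using x nonsquare_a coefficients
      by (simp_all add: b_mult_nonsquare_in_unit_hull is_square_mult_nonsquares)
    moreover have "b * x \<noteq> 0"
      using x(2) coefficients by auto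
    ultimately show ?thesis
      using only by blast
  qed
  have b_mult_a: "b * a = 1"
    by (rule b_mult [OF a_in_unit_hull nonsquare_a])
  then show "a * b = 1"
    by (simp add: mult.commute)
  have "x = a" if "x \<in> unit_hull a b" "\<not> is_square x" for x
    using b_mult [OF that] b_mult_a coefficients by (metis mult_left_cancel)
  then show "unit_hull a b = {0, 1, a}"
    using only zero_in_unit_hull one_in_unit_hull a_in_unit_hull by blast
qed

lemma three_point_unit_hull:
  assumes nonsquare_a: "\<not> is_square a" and "a * b = 1" and "unit_hull a b = {0, 1, a}"
  shows "\<not> is_square (- 1 :: 'a)" "a + b = 1"
proof -
  note coefficients = quadratic [unfolded is_quadratic_quasigroup_iff]
  have quad_op_1_0: "quad_op a b 1 0 \<in> {0, 1, a}"
    using quad_op_in_unit_hull [OF one_in_unit_hull zero_in_unit_hull] assms(3) by simp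
  show nonsquare_minus_1: "\<not> is_square (- 1 :: 'a)"
  proof
    assume square: "is_square (- 1 :: 'a)"
    then have "1 - a = a"
      using quad_op_1_0 coefficients by (auto simp: quad_op_eq_add quad_scale_def)
    have "b - a * b = (1 - a) * b"
      by (simp add: left_diff_distrib)
    also have "\<dots> = 1"
      unfolding \<open>1 - a = a\<close> by (rule \<open>a * b = 1\<close>)
    finally have "1 - b = - 1"
      using \<open>a * b = 1\<close> by (simp add: algebra_simps)
    then show False
      using square \<open>1 - a = a\<close> nonsquare_a coefficients by metis
  qed
  have "1 - b = a"
    using quad_op_1_0 coefficients nonsquare_minus_1 by (auto simp: quad_op_eq_add quad_scale_def)
  then show "a + b = 1"
    by (simp add: algebra_simps)
qed

end

locale non_netto_quadratic_quasigroup = quadratic_quasigroup a b for a b :: "'a::finite_field" +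
  assumes non_netto: "\<not> is_netto_quasigroup a b"
begin

lemma three_eq_0_if_netto_relations:
  assumes "a * b = 1" "a + b = 1" "\<not> is_square a" "\<not> is_square (- 1 :: 'a)"
  shows "(3 :: 'a) = 0"
proof -
  have "\<not> CHAR('a) > 3"
    using assms quadratic non_netto
    by (simp add: is_netto_quasigroup_def quad_char_eq_minus_1_iff)
  moreover have "CHAR('a) \<noteq> 2"
  proof
    assume "CHAR('a) = 2"
    then have "(1 :: 'a) + 1 = 0"
      by (metis of_nat_CHAR of_nat_numeral one_add_one)
    then show False
      using assms(4) by (metis is_nth_power_1 minus_unique)
  qed
  moreover have "CHAR('a) \<ge> 2"
    by (intro prime_ge_2_nat CHAR_prime)
  ultimately have "CHAR('a) = 3"
    by linarith
  then show ?thesis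
    by (metis of_nat_CHAR of_nat_numeral)
qed

lemma subfield_set_unit_hull: "subfield_set (unit_hull a b)"
proof (cases "\<exists>s\<in>unit_hull a b. is_square s \<and> s \<noteq> 0 \<and> s \<noteq> 1")
  case True
  then show ?thesis
    using subfield_set_unit_hull_of_square by blast
next
  case False
  then have "\<forall>s\<in>unit_hull a b. is_square s \<longrightarrow> s = 0 \<or> s = 1"
    by blast
  note three_points = unit_hull_without_squares [OF this]
  note relations = three_point_unit_hull [OF three_points]
  have three: "(3 :: 'a) = 0"
    using three_eq_0_if_netto_relations three_points(1,2) relations by blast
  then have two: "(2 :: 'a) = - 1"
    by (simp add: eq_neg_iff_add_eq_0)
  have "b = 1 - a"
    using relations(2) by (simp add: algebra_simps)
  have "(a + 1) * (a + 1) = 3 * a + (1 - a * b)"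
    by (subst \<open>b = 1 - a\<close>) (simp add: algebra_simps)
  then have "a = - 1"
    using three_points(2) three by (simp add: eq_neg_iff_add_eq_0)
  then show ?thesis
    unfolding three_points(3) by (intro subfield_setI) (auto simp: two)
qed

lemma subfield_generated_subset_unit_hull:
  "X \<subseteq> unit_hull a b \<Longrightarrow> subfield_generated X \<subseteq> unit_hull a b"
  unfolding subfield_generated_eq_hull by (intro hull_minimal subfield_set_unit_hull)

lemma unit_hull_subset_subfield_generated:
  assumes "a \<in> X" "b \<in> X \<or> (\<forall>x\<in>subfield_generated X. is_square x)"
  shows "unit_hull a b \<subseteq> subfield_generated X"
  using assms subfield_set_subfield_generated [of X]
  by (intro unit_hull_subset op_closed_quad_op) (auto simp: subfield_generated_eq_hull hull_inc)

lemma unit_hull_eq: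
  "unit_hull a b = (if \<forall>x\<in>subfield_generated {a}. is_square x
        then subfield_generated {a} else subfield_generated {a, b})"
proof (cases "\<forall>x\<in>subfield_generated {a}. is_square x")
  case True
  then show ?thesis
    using subfield_generated_subset_unit_hull [of "{a}"] a_in_unit_hull
      unit_hull_subset_subfield_generated [of "{a}"] by auto
next
  case False
  then obtain z where z: "z \<in> unit_hull a b" "\<not> is_square z"
    using subfield_generated_subset_unit_hull [of "{a}"] a_in_unit_hull by blast
  then have "b * z / z \<in> unit_hull a b"
    by (intro subfield_set_divide subfield_set_unit_hull b_mult_nonsquare_in_unit_hull)
  moreover have "z \<noteq> 0"
    using z(2) by auto
  ultimately have "b \<in> unit_hull a b"
    by simp
  then have "subfield_generated {a, b} \<subseteq> unit_hull a b"
    by (simp add: subfield_generated_subset_unit_hull a_in_unit_hull)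
  moreover have "unit_hull a b \<subseteq> subfield_generated {a, b}"
    by (simp add: unit_hull_subset_subfield_generated)
  ultimately show ?thesis
    using False by auto
qed

lemma swap_coefficients: "non_netto_quadratic_quasigroup b a"
  using quadratic non_netto
  by unfold_locales
    (auto simp: is_netto_quasigroup_def is_quadratic_quasigroup_def add.commute mult.commute)

sublocale line_quasigroup "quad_op a b" "line_hull a b"
  using subfield_set_unit_hull
    non_netto_quadratic_quasigroup.subfield_set_unit_hull [OF swap_coefficients]
  by unfold_locales (simp_all add: line_hull_def hull_pair_quad_op)

lemma line_hull_1:
  "line_hull a b 1 =
    (if \<forall>x\<in>subfield_generated {a}. is_square x
     then subfield_generated {a} else subfield_generated {a, b})"
  by (simp add: line_hull_def unit_hull_eq)

lemma line_hull_minus_1: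
  "line_hull a b (- 1) =
    (if \<forall>x\<in>subfield_generated {b}. is_square x
     then subfield_generated {b} else subfield_generated {a, b})"
  by (simp add: line_hull_def non_netto_quadratic_quasigroup.unit_hull_eq [OF swap_coefficients]
      insert_commute [of b a])

lemma nonminimal_two_generated_cases:
  assumes "\<exists>S. two_generated (quad_op a b) S \<and> \<not> trivial_subquasigroup (quad_op a b) S \<and>
    \<not> minimal_subquasigroup (quad_op a b) S"
  obtains (i) "\<forall>x\<in>subfield_generated {b}. is_square x" "\<exists>x\<in>subfield_generated {a}. \<not> is_square x"
      "line_hull a b 1 = subfield_generated {a, b}"
      "line_hull a b (- 1) = subfield_generated {b}"
      "mixed_line_quasigroup (quad_op a b) (line_hull a b) 1"
  | (ii) "\<forall>x\<in>subfield_generated {a}. is_square x" "\<exists>x\<in>subfield_generated {b}. \<not> is_square x"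
      "line_hull a b (- 1) = subfield_generated {a, b}"
      "line_hull a b 1 = subfield_generated {a}"
      "mixed_line_quasigroup (quad_op a b) (line_hull a b) (- 1)"
proof -
  let ?K0 = "subfield_generated {a}" and ?K1 = "subfield_generated {b}"
  have subsets: "?K0 \<subseteq> subfield_generated {a, b}" "?K1 \<subseteq> subfield_generated {a, b}"
    unfolding subfield_generated_eq_hull by (rule hull_mono; simp)+
  have "line_hull a b 1 \<noteq> line_hull a b (- 1)"
    "\<exists>k\<in>line_hull a b 1 \<union> line_hull a b (- 1). \<not> is_square k"
    using assms nonminimal_imp_mixed_fields by blast+
  then consider (nonsquare_K0) "\<forall>x\<in>?K1. is_square x" "\<exists>x\<in>?K0. \<not> is_square x"
    | (nonsquare_K1) "\<forall>x\<in>?K0. is_square x" "\<exists>x\<in>?K1. \<not> is_square x"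
    by (auto simp: line_hull_1 line_hull_minus_1 split: if_splits)
  then show ?thesis
  proof cases
    case nonsquare_K0
    moreover from this have fields: "line_hull a b 1 = subfield_generated {a, b}"
      "line_hull a b (- 1) = ?K1"
      by (auto simp: line_hull_1 line_hull_minus_1)
    moreover have "mixed_line_quasigroup (quad_op a b) (line_hull a b) 1"
      using nonsquare_K0 subsets(1) fields by unfold_locales auto
    ultimately show ?thesis
      by (rule i)
  next
    case nonsquare_K1
    moreover from this have fields: "line_hull a b (- 1) = subfield_generated {a, b}"
      "line_hull a b 1 = ?K0"
      by (auto simp: line_hull_1 line_hull_minus_1)
    moreover have "mixed_line_quasigroup (quad_op a b) (line_hull a b) (- 1)"
      using nonsquare_K1 subsets(2) fields by unfold_locales auto
    ultimately show ?thesis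
      by (rule ii)
  qed
qed

lemma squares_of_subfield_generated:
  assumes "c = a \<or> c = b" and squares: "\<forall>x\<in>subfield_generated {c}. is_square x"
  shows "is_square (- 1 :: 'a) \<and> is_square a \<and> is_square b \<and>
    is_square (1 - a) \<and> is_square (1 - b)"
proof -
  note subfield_c = subfield_set_subfield_generated [of "{c}"]
  have "c \<in> subfield_generated {c}"
    by (simp add: subfield_generated_eq_hull hull_inc)
  then have "- 1 \<in> subfield_generated {c}" "1 - c \<in> subfield_generated {c}"
    by (simp_all add: subfield_c subfield_set_uminus subfield_set_diff subfield_set_one)
  then have "is_square (- 1 :: 'a)" "is_square c" "is_square (1 - c)"
    using squares \<open>c \<in> subfield_generated {c}\<close> by blast+
  then show ?thesis
    using assms(1) quadratic by (auto simp: is_quadratic_quasigroup_iff)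
qed

end

theorem theorem5p5:
  fixes a b :: "'a::finite_field" and K K0 K1 :: "'a set"
  defines "K \<equiv> subfield_generated {a, b}"
    and "K0 \<equiv> subfield_generated {a}"
    and "K1 \<equiv> subfield_generated {b}"
  assumes "odd CARD('a)"
    and "is_quadratic_quasigroup a b"
    and "\<not> is_netto_quasigroup a b"
    and "\<exists>S. two_generated (quad_op a b) S \<and>
             \<not> trivial_subquasigroup (quad_op a b) S \<and> \<not> minimal_subquasigroup (quad_op a b) S"
  shows "{S. two_generated (quad_op a b) S \<and>
             \<not> trivial_subquasigroup (quad_op a b) S \<and> \<not> minimal_subquasigroup (quad_op a b) S}
           = {affine_image l K m | l m. l \<noteq> 0} \<and>
         is_square (- 1 :: 'a) \<and> is_square a \<and> is_square b \<and> is_square (1 - a) \<and> is_square (1 - b) \<and>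
         (((\<forall>x\<in>K1. x \<noteq> 0 \<longrightarrow> is_square x) \<and> (\<exists>x\<in>K0. \<not> is_square x) \<and>
           (\<forall>s\<in>K. subquasigroup_generated_by (quad_op a b) {0, s} K \<longleftrightarrow> quad_char s = 1) \<and>
           subquasigroup_generated_by (quad_op a b) {0, 1} K \<and>
           {S. minimal_subquasigroup (quad_op a b) S}
             = {affine_image z K1 m | z m. quad_char z = - 1})
          \<or>
          ((\<forall>x\<in>K0. x \<noteq> 0 \<longrightarrow> is_square x) \<and> (\<exists>x\<in>K1. \<not> is_square x) \<and>
           (\<forall>z\<in>K. subquasigroup_generated_by (quad_op a b) {0, z} K \<longleftrightarrow> quad_char z = - 1) \<and>
           {S. minimal_subquasigroup (quad_op a b) S}
             = {affine_image s K0 m | s m. quad_char s = 1}))"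
proof -
  interpret non_netto_quadratic_quasigroup a b
    by unfold_locales (fact assms)+
  from assms(7) show ?thesis
  proof (cases rule: nonminimal_two_generated_cases)
    case i
    interpret mixed_line_quasigroup "quad_op a b" "line_hull a b" 1
      by (fact i(5))
    note lines = nonminimal_two_generated_eq generated_by_zero_iff minimal_subquasigroups_eq
    have "subquasigroup_generated_by (quad_op a b) {0, 1} (line_hull a b 1)"
      using generated_by_zero_iff subfield_set_one [OF subfield] by (simp add: quad_char_def)
    then show ?thesis
      using i(1,2,3) squares_of_subfield_generated [of b] unfolding K_def K0_def K1_def
      by (intro conjI disjI1 ballI lines [unfolded i(3,4)]) auto
  next
    case ii
    interpret mixed_line_quasigroup "quad_op a b" "line_hull a b" "- 1"
      by (fact ii(5))
    note lines = nonminimal_two_generated_eq generated_by_zero_iff minimal_subquasigroups_eq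
    show ?thesis
      using ii(1,2) squares_of_subfield_generated [of a] unfolding K_def K0_def K1_def
      by (intro conjI disjI2 ballI lines [unfolded minus_minus ii(3,4)]) auto
  qed
qed

end
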